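(* For every positive integer $n$ there exist infinitely many integers $h$ such that the quartic equation $$\begin{aligned} &x_1^4-11x_1^2x_2^2+x_2^4+x_3^4+6x_3^3x_4+7x_3^2x_4^2-6x_3x_4^3+x_4^4\\ &+h\,(4x_1^2x_2x_3-2x_1^2x_2x_4+x_1^2x_3^2-3x_1^2x_3x_4+2x_1^2x_4^2\\ &\quad+2x_2^3x_3+8x_2^3x_4+3x_2^2x_3^2+6x_2^2x_3x_4-15x_2^2x_4^2\\ &\quad-x_2x_3^3-4x_2x_3^2x_4-2x_2x_3x_4^2+x_2x_4^3)=0 \end{aligned}$$ has at least $n$ distinct rational (hence, on scaling, integer) solutions $(x_1,x_2,x_3,x_4)$.
   Context: Solutions differing by a nonzero rational scalar factor are considered equivalent and are counted as one solution; solutions considered satisfy $(x_1,x_2)\neq(0,0)$ and $(x_3,x_4)\neq(0,0)$. *)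

theory Defs
  imports Complex_Main
begin

type_synonym 'a quadruple = "'a \<times> 'a \<times> 'a \<times> 'a"

fun quartic :: "int \<Rightarrow> rat quadruple \<Rightarrow> rat" where
  "quartic h (x1, x2, x3, x4) =
     x1^4 - 11 * x1^2 * x2^2 + x2^4 + x3^4 + 6 * x3^3 * x4 + 7 * x3^2 * x4^2
       - 6 * x3 * x4^3 + x4^4
     + of_int h *
       (4 * x1^2 * x2 * x3 - 2 * x1^2 * x2 * x4 + x1^2 * x3^2 - 3 * x1^2 * x3 * x4
          + 2 * x1^2 * x4^2
        + 2 * x2^3 * x3 + 8 * x2^3 * x4 + 3 * x2^2 * x3^2 + 6 * x2^2 * x3 * x4
          - 15 * x2^2 * x4^2
        - x2 * x3^3 - 4 * x2 * x3^2 * x4 - 2 * x2 * x3 * x4^2 + x2 * x4^3)"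

definition solutions :: "int \<Rightarrow> rat quadruple set" where
  "solutions h = {(x1, x2, x3, x4).
     quartic h (x1, x2, x3, x4) = 0 \<and> (x1, x2) \<noteq> (0, 0) \<and> (x3, x4) \<noteq> (0, 0)}"

fun scale :: "rat \<Rightarrow> rat quadruple \<Rightarrow> rat quadruple" where
  "scale c (x1, x2, x3, x4) = (c * x1, c * x2, c * x3, c * x4)"

definition equivalent :: "rat quadruple \<Rightarrow> rat quadruple \<Rightarrow> bool" where
  "equivalent x y \<longleftrightarrow> (\<exists>c. c \<noteq> 0 \<and> y = scale c x)"

fun integral_quadruple :: "rat quadruple \<Rightarrow> bool" where
  "integral_quadruple (x1, x2, x3, x4) \<longleftrightarrow>
     x1 \<in> \<int> \<and> x2 \<in> \<int> \<and> x3 \<in> \<int> \<and> x4 \<in> \<int>"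

end

theory Submission
  imports Defs "HOL-Number_Theory.Cong"
begin

text \<open>
  Let \<open>\<alpha>\<close> be a root of \<open>\<alpha>\<^sup>2 = 3\<alpha> + 1\<close>, so that \<open>K = \<rat>(\<alpha>) = \<rat>(\<surd>13)\<close>, and write \<open>\<alpha>'\<close> for its
  conjugate. Identifying \<open>(x\<^sub>1, x\<^sub>2, x\<^sub>3, x\<^sub>4)\<close> with the pair
  \<open>(x\<^sub>1 - \<alpha>' x\<^sub>2, x\<^sub>3 + \<alpha> x\<^sub>4)\<close> makes rational 4-space a plane over \<open>K\<close>. For every \<open>h\<close> the quartic
  surface contains the line on which this pair vanishes and the conjugate line. These two lines are
  skew, so each rational point \<open>x\<close> lies on one line meeting both of them, namely the projective line
  of all \<open>\<kappa> x\<close> with \<open>\<kappa>\<close> in \<open>K\<close>. That line meets the surface in four points; two of them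
  lie on the two given lines and are conjugate, and \<open>x\<close> is a third, so the fourth is again rational. Concretely,
  the quartic at \<open>(k + l\<alpha>) x\<close> is the norm of \<open>k + l\<alpha>\<close> times a binary quadratic form in \<open>k, l\<close>
  (lemma \<open>form_twist\<close>), and \<open>l = 0\<close> is one zero of the latter.

  Composing this residual involution with the symmetry \<open>x\<^sub>1 \<mapsto> -x\<^sub>1\<close> gives a map of the surface to
  itself (\<open>step\<close>), which is iterated from \<open>(1, 1, 1, 1)\<close>, a solution for all \<open>h\<close>. All formulas are
  polynomial in \<open>h\<close>, so the orbit for \<open>h\<close> is congruent modulo \<open>h\<close> to the orbit for \<open>h = 0\<close>
  (lemma \<open>orbit_cong\<close>). The latter is explicit: up to scaling, its \<open>m\<close>-th point is
  \<open>(3\<^sup>m, 3\<^sup>m, y, z)\<close> with \<open>y\<close> prime to 3 (lemma \<open>orbit_0\<close>), so its points are pairwise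
  projectively distinct. The finitely many nonzero integers that witness this for the
  first \<open>n\<close> points are not divisible by any large \<open>h\<close>, so for every large \<open>h\<close> the first \<open>n\<close>
  points of the orbit are \<open>n\<close> inequivalent integer solutions.
\<close>

section \<open>The residual point on a transversal\<close>

fun form :: "int \<Rightarrow> int quadruple \<Rightarrow> int" where
  "form h (x1, x2, x3, x4) =
     x1^4 - 11 * x1^2 * x2^2 + x2^4 + x3^4 + 6 * x3^3 * x4 + 7 * x3^2 * x4^2
       - 6 * x3 * x4^3 + x4^4
     + h *
       (4 * x1^2 * x2 * x3 - 2 * x1^2 * x2 * x4 + x1^2 * x3^2 - 3 * x1^2 * x3 * x4
          + 2 * x1^2 * x4^2
        + 2 * x2^3 * x3 + 8 * x2^3 * x4 + 3 * x2^2 * x3^2 + 6 * x2^2 * x3 * x4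
          - 15 * x2^2 * x4^2
        - x2 * x3^3 - 4 * x2 * x3^2 * x4 - 2 * x2 * x3 * x4^2 + x2 * x4^3)"

fun rat_point :: "int quadruple \<Rightarrow> rat quadruple" where
  "rat_point (x1, x2, x3, x4) = (of_int x1, of_int x2, of_int x3, of_int x4)"

lemma quartic_rat_point: "quartic h (rat_point x) = of_int (form h x)"
  by (cases x) simp

text \<open>Multiplication by \<open>k + l\<alpha>\<close> in the \<open>K\<close>-plane with coordinates
  \<open>x\<^sub>1 - \<alpha>' x\<^sub>2 = (x\<^sub>1 - 3 x\<^sub>2) + \<alpha> x\<^sub>2\<close> and \<open>x\<^sub>3 + \<alpha> x\<^sub>4\<close>.\<close>
fun twist :: "int \<Rightarrow> int \<Rightarrow> int quadruple \<Rightarrow> int quadruple" where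
  "twist k l (x1, x2, x3, x4) =
     (k * x1 + l * (3 * x1 + x2), k * x2 + l * x1, k * x3 + l * x4, k * x4 + l * (x3 + 3 * x4))"

text \<open>Four independent quadrics through both lines: the norms of the two \<open>K\<close>-coordinates \<open>a, b\<close> and
  two rational components of \<open>a b'\<close>, all of which \<open>\<kappa>\<close> multiplies by its norm.\<close>
fun base_quadric :: "nat \<Rightarrow> int quadruple \<Rightarrow> int" where
  "base_quadric 0 (x1, x2, x3, x4) = x1^2 - 3 * x1 * x2 - x2^2"
| "base_quadric (Suc 0) (x1, x2, x3, x4) = x1 * x3 - x2 * x4"
| "base_quadric (Suc (Suc 0)) (x1, x2, x3, x4) = x2 * x3 - x1 * x4 + 3 * x2 * x4"
| "base_quadric (Suc (Suc (Suc _))) (x1, x2, x3, x4) = x3^2 + 3 * x3 * x4 - x4^2"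

fun cofactor :: "int \<Rightarrow> nat \<Rightarrow> int quadruple \<Rightarrow> int" where
  "cofactor h 0 (x1, x2, x3, x4) =
     x1^2 + 3 * x1 * x2 - x2^2 + h * (x3^2 - 3 * x3 * x4 + 2 * x4^2 - 2 * x2 * x4)"
| "cofactor h (Suc 0) (x1, x2, x3, x4) = h * (x2 * (4 * x1 + 3 * x3 - 9 * x4))"
| "cofactor h (Suc (Suc 0)) (x1, x2, x3, x4) = h * (2 * x2 * (x2 - 3 * x4))"
| "cofactor h (Suc (Suc (Suc _))) (x1, x2, x3, x4) =
     x3^2 + 3 * x3 * x4 - x4^2 + h * (x2 * (4 * x2 - x3 - x4))"

lemma sum_lessThan_4: "(\<Sum>i<4. f i) = f 0 + f (Suc 0) + f (Suc (Suc 0)) + f (Suc (Suc (Suc 0)))"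
  for f :: "nat \<Rightarrow> int"
  by (simp add: eval_nat_numeral)

text \<open>That the surface contains the two lines means that the quartic lies in the ideal of the quadrics
  through them; the cofactors exhibit this.\<close>
lemma form_decomposition: "form h x = (\<Sum>i<4. base_quadric i x * cofactor h i x)"
proof (cases x)
  case (fields x1 x2 x3 x4)
  show ?thesis
    unfolding fields form.simps sum_lessThan_4 base_quadric.simps cofactor.simps
    by (simp add: algebra_simps power2_eq_square power3_eq_cube power4_eq_xxxx)
qed

lemma base_quadric_twist:
  "base_quadric i (twist k l x) = (k^2 + 3 * k * l - l^2) * base_quadric i x"
  by (induction i x rule: base_quadric.induct)
    (unfold base_quadric.simps twist.simps, algebra+)

text \<open>For a quadratic form \<open>P\<close>, the coefficient of \<open>kl\<close> in \<open>P\<close> at \<open>(k + l\<alpha>) x\<close>.\<close>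
definition polar :: "(int quadruple \<Rightarrow> int) \<Rightarrow> int quadruple \<Rightarrow> int" where
  "polar P x = P (twist 1 1 x) - P x - P (twist 0 1 x)"

lemma cofactor_twist:
  "cofactor h i (twist k l x) =
     cofactor h i x * k^2 + polar (cofactor h i) x * k * l + cofactor h i (twist 0 1 x) * l^2"
  by (induction h i x rule: cofactor.induct)
    (unfold polar_def cofactor.simps twist.simps, algebra+)

definition coeff_kl :: "int \<Rightarrow> int quadruple \<Rightarrow> int" where
  "coeff_kl h x = (\<Sum>i<4. base_quadric i x * polar (cofactor h i) x)"

definition coeff_ll :: "int \<Rightarrow> int quadruple \<Rightarrow> int" where
  "coeff_ll h x = (\<Sum>i<4. base_quadric i x * cofactor h i (twist 0 1 x))"

text \<open>The choice \<open>(k, l) = (coeff_ll, -coeff_kl)\<close> makes the second factor vanish when \<open>x\<close> is a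
  solution; this is the new solution on the transversal of \<open>x\<close>.\<close>
lemma form_twist:
  "form h (twist k l x) =
     (k^2 + 3 * k * l - l^2) * (form h x * k^2 + coeff_kl h x * k * l + coeff_ll h x * l^2)"
  unfolding form_decomposition coeff_kl_def coeff_ll_def base_quadric_twist
    cofactor_twist[of h _ k l x]
  by (simp only: sum_distrib_left sum_distrib_right sum.distrib[symmetric])
    (rule sum.cong[OF refl], algebra)

fun reflect :: "int quadruple \<Rightarrow> int quadruple" where
  "reflect (x1, x2, x3, x4) = (- x1, x2, x3, x4)"

lemma form_reflect: "form h (reflect x) = form h x"
  by (cases x) simp

definition residual :: "int \<Rightarrow> int quadruple \<Rightarrow> int quadruple" where
  "residual h x = twist (coeff_ll h x) (- coeff_kl h x) x"

lemma form_residual: "form h x = 0 \<Longrightarrow> form h (residual h x) = 0"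
  by (simp add: residual_def form_twist power2_eq_square)

definition step :: "int \<Rightarrow> int quadruple \<Rightarrow> int quadruple" where
  "step h x = residual h (reflect x)"

definition orbit :: "int \<Rightarrow> nat \<Rightarrow> int quadruple" where
  "orbit h m = (step h ^^ m) (1, 1, 1, 1)"

lemma orbit_Suc: "orbit h (Suc m) = step h (orbit h m)"
  by (simp add: orbit_def)

lemma form_orbit: "form h (orbit h m) = 0"
proof (induction m)
  case 0
  then show ?case by (simp add: orbit_def)
next
  case (Suc m)
  then show ?case by (simp add: orbit_Suc step_def form_residual form_reflect)
qed

section \<open>Reduction of the orbit modulo h\<close>

fun cong4 :: "int \<Rightarrow> int quadruple \<Rightarrow> int quadruple \<Rightarrow> bool" where
  "cong4 h (x1, x2, x3, x4) (y1, y2, y3, y4) \<longleftrightarrow>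
     [x1 = y1] (mod h) \<and> [x2 = y2] (mod h) \<and> [x3 = y3] (mod h) \<and> [x4 = y4] (mod h)"

lemma cong_self_mult_0: "[h * c = 0 * d] (mod h)" for h :: int
  by (simp add: cong_def)

lemma twist_cong:
  assumes "[k = k'] (mod h)" "[l = l'] (mod h)" "cong4 h x y"
  shows "cong4 h (twist k l x) (twist k' l' y)"
  using assms by (cases x; cases y) (simp, intro conjI cong_add cong_mult cong_refl; elim conjE; assumption)

lemma base_quadric_cong:
  assumes "cong4 h x y"
  shows "[base_quadric i x = base_quadric i y] (mod h)"
  using assms
  by (cases "(i, x)" rule: base_quadric.cases; cases y)
    (simp_all only: prod.inject cong4.simps base_quadric.simps,
     (intro cong_add cong_diff cong_mult cong_pow cong_refl; elim conjE; assumption)+)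

lemma cofactor_cong:
  assumes "cong4 h x y"
  shows "[cofactor h i x = cofactor 0 i y] (mod h)"
  using assms
  by (cases "(i, x)" rule: base_quadric.cases; cases y)
    (simp_all only: prod.inject cong4.simps cofactor.simps,
     (intro cong_self_mult_0 cong_add cong_diff cong_mult cong_pow cong_refl; elim conjE; assumption)+)

lemma coeff_cong:
  assumes "cong4 h x y"
  shows "[coeff_kl h x = coeff_kl 0 y] (mod h)" and "[coeff_ll h x = coeff_ll 0 y] (mod h)"
  unfolding coeff_kl_def coeff_ll_def polar_def
  by (intro cong_sum cong_mult cong_diff base_quadric_cong cofactor_cong twist_cong cong_refl assms)+

lemma step_cong:
  assumes "cong4 h x y"
  shows "cong4 h (step h x) (step 0 y)"
proof -
  have "cong4 h (reflect x) (reflect y)"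
    using assms by (cases x; cases y) (simp add: cong_minus_minus_iff)
  then show ?thesis
    unfolding step_def residual_def
    by (intro twist_cong coeff_cong) (simp_all only: cong_minus_minus_iff coeff_cong)
qed

lemma orbit_cong: "cong4 h (orbit h m) (orbit 0 m)"
  by (induction m) (simp_all add: orbit_def step_cong)

section \<open>The orbit at h = 0\<close>

text \<open>For \<open>h = 0\<close> the points with \<open>x\<^sub>1 = x\<^sub>2 = t\<close> form the pair of conics
  \<open>x\<^sub>3\<^sup>2 + 3x\<^sub>3x\<^sub>4 - x\<^sub>4\<^sup>2 = \<plusminus>3t\<^sup>2\<close>, and there one step multiplies \<open>x\<^sub>3 + \<alpha>x\<^sub>4\<close> by
  \<open>(1 - 2\<alpha>) / 3\<close>.\<close>
lemma step_0_diagonal: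
  assumes "(y^2 + 3 * y * z - z^2)^2 = 9 * t^4"
  shows "step 0 (g * t, g * t, g * y, g * z) =
    (let g' = 18 * g^5 * t^4 in (g' * (3 * t), g' * (3 * t), g' * (y - 2 * z), g' * (-2 * y - 5 * z)))"
proof -
  let ?x = "(- (g * t), g * t, g * y, g * z)"
  have s: "((g * y)^2 + 3 * (g * y) * (g * z) - (g * z)^2)^2 = 9 * g^4 * t^4"
    using assms by algebra
  have kl: "coeff_kl 0 ?x = 36 * g^4 * t^4" and ll: "coeff_ll 0 ?x = 18 * g^4 * t^4"
    using s by (simp_all add: coeff_kl_def coeff_ll_def polar_def sum_lessThan_4) algebra+
  show ?thesis
    unfolding step_def residual_def reflect.simps kl ll twist.simps Let_def prod.inject
    by (intro conjI; algebra)
qed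

text \<open>The multiplier \<open>(1 - 2\<alpha>) / 3\<close> has norm \<open>-1\<close> but is not integral, its numerator being the square
  of a prime above 3 up to a unit. Hence each step puts another factor 3 into the denominator,
  provided nothing cancels. Modulo the other prime above 3, where \<open>\<alpha> \<equiv> 1\<close>, the numerator is a unit
  and \<open>y + \<alpha>z \<equiv> y + z \<equiv> 2y\<close> when \<open>y \<equiv> z\<close>; so the two conditions modulo 3 persist and
  exclude cancellation.\<close>
lemma orbit_0:
  "\<exists>g y z. orbit 0 m = (g * 3^m, g * 3^m, g * y, g * z) \<and> g \<noteq> 0
     \<and> (y^2 + 3 * y * z - z^2)^2 = 9 * (3^m)^4 \<and> [y = z] (mod 3) \<and> \<not> 3 dvd y"
proof (induction m)
  case 0
  show ?case
    by (intro exI[of _ 1]) (simp add: orbit_def)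
next
  case (Suc m)
  then obtain g y z where o: "orbit 0 m = (g * 3^m, g * 3^m, g * y, g * z)" and g: "g \<noteq> 0"
    and q: "(y^2 + 3 * y * z - z^2)^2 = 9 * (3^m)^4" and yz: "[y = z] (mod 3)" and y: "\<not> 3 dvd y"
    by blast
  let ?g = "18 * g^5 * (3^m)^4" and ?y = "y - 2 * z" and ?z = "-2 * y - 5 * z"
  have "?y^2 + 3 * ?y * ?z - ?z^2 = -9 * (y^2 + 3 * y * z - z^2)"
    by algebra
  then have q': "(?y^2 + 3 * ?y * ?z - ?z^2)^2 = 9 * (3^Suc m)^4"
    using q by (simp only: power_mult_distrib power_Suc) simp
  have "[?y = ?z] (mod 3)" "\<not> 3 dvd ?y"
    using yz y by (simp_all add: cong_iff_dvd_diff) presburger+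
  moreover have "orbit 0 (Suc m) = (?g * 3^Suc m, ?g * 3^Suc m, ?g * ?y, ?g * ?z)"
    unfolding orbit_Suc o step_0_diagonal[OF q] Let_def by simp
  moreover have "?g \<noteq> 0" using g by simp
  ultimately show ?case using q' by blast
qed

fun minor :: "int quadruple \<Rightarrow> int quadruple \<Rightarrow> int" where
  "minor (x1, x2, x3, x4) (y1, y2, y3, y4) = x1 * y3 - y1 * x3"

lemma minor_orbit_0:
  assumes "i < j"
  shows "minor (orbit 0 i) (orbit 0 j) \<noteq> 0"
proof -
  obtain g y z where i: "orbit 0 i = (g * 3^i, g * 3^i, g * y, g * z)" "g \<noteq> 0"
    using orbit_0[of i] by blast
  obtain g' y' z' where j: "orbit 0 j = (g' * 3^j, g' * 3^j, g' * y', g' * z')" "g' \<noteq> 0"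
    and y': "\<not> 3 dvd y'"
    using orbit_0[of j] by blast
  obtain d where d: "j = i + Suc d"
    using assms less_iff_Suc_add by auto
  have "minor (orbit 0 i) (orbit 0 j) = g * g' * 3^i * (y' - 3 * 3^d * y)"
    unfolding i(1) j(1) minor.simps unfolding d by (simp add: power_add algebra_simps)
  moreover have "y' \<noteq> 3 * 3^d * y"
    using y' by (metis dvd_triv_left mult.assoc)
  ultimately show ?thesis using i j by simp
qed

section \<open>Inequivalent solutions for large h\<close>

lemma orbit_in_solutions:
  assumes "\<not> h dvd fst (orbit 0 m)" and "\<not> h dvd fst (snd (snd (orbit 0 m)))"
  shows "rat_point (orbit h m) \<in> solutions h"
proof -
  obtain x1 x2 x3 x4 where x: "orbit h m = (x1, x2, x3, x4)" by (cases "orbit h m")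
  obtain y1 y2 y3 y4 where y: "orbit 0 m = (y1, y2, y3, y4)" by (cases "orbit 0 m")
  have "[x1 = y1] (mod h)" "[x3 = y3] (mod h)"
    using orbit_cong[of h m] by (auto simp: x y)
  then have "x1 \<noteq> 0" "x3 \<noteq> 0"
    using assms by (auto simp: y dest: cong_dvd_iff)
  moreover have "quartic h (rat_point (orbit h m)) = 0"
    by (simp only: quartic_rat_point form_orbit of_int_0)
  ultimately show ?thesis
    by (simp add: solutions_def x del: quartic.simps)
qed

lemma orbit_inequivalent:
  assumes "\<not> h dvd minor (orbit 0 i) (orbit 0 j)"
  shows "\<not> equivalent (rat_point (orbit h i)) (rat_point (orbit h j))"
proof
  assume e: "equivalent (rat_point (orbit h i)) (rat_point (orbit h j))"
  obtain x1 x2 x3 x4 where x: "orbit h i = (x1, x2, x3, x4)" by (cases "orbit h i")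
  obtain y1 y2 y3 y4 where y: "orbit h j = (y1, y2, y3, y4)" by (cases "orbit h j")
  obtain c :: rat where "of_int y1 = c * of_int x1" "of_int y3 = c * of_int x3"
    using e by (auto simp: equivalent_def x y)
  then have "(of_int (x1 * y3) :: rat) = of_int (y1 * x3)"
    by simp
  then have "minor (orbit h i) (orbit h j) = 0"
    unfolding of_int_eq_iff by (simp add: x y)
  moreover have "[minor (orbit h i) (orbit h j) = minor (orbit 0 i) (orbit 0 j)] (mod h)"
    using orbit_cong[of h i] orbit_cong[of h j]
    by (cases "orbit 0 i", cases "orbit 0 j") (auto simp: x y intro!: cong_diff cong_mult)
  ultimately show False
    using assms by (auto dest: cong_dvd_iff)
qed

lemma equivalent_sym: "equivalent x y \<Longrightarrow> equivalent y x"
  unfolding equivalent_def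
proof (elim exE conjE)
  fix c :: rat
  assume "c \<noteq> 0" "y = scale c x"
  then show "\<exists>c. c \<noteq> 0 \<and> x = scale c y"
    by (intro exI[of _ "inverse c"]) (cases x; simp)
qed

lemma equivalent_refl: "equivalent x x"
  unfolding equivalent_def by (intro exI[of _ 1]) (cases x; simp)

lemma eventually_not_dvd:
  fixes d :: int
  assumes "d \<noteq> 0"
  shows "eventually (\<lambda>h. \<not> h dvd d) at_top"
  using eventually_gt_at_top[of "\<bar>d\<bar>"]
proof eventually_elim
  case (elim h)
  show ?case
    using dvd_imp_le_int[OF assms, of h] elim by linarith
qed

lemma infinite_if_eventually:
  fixes P :: "int \<Rightarrow> bool"
  assumes "eventually P at_top"
  shows "infinite {h. P h}"
proof -
  obtain N where "{N..} \<subseteq> {h. P h}"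
    using assms unfolding eventually_at_top_linorder by blast
  then show ?thesis
    using infinite_Ici infinite_super by blast
qed

theorem mainTheorem3:
  fixes n :: nat
  assumes "n \<ge> 1"
  shows "infinite {h :: int. \<exists>S. S \<subseteq> solutions h \<and> finite S \<and> card S = n \<and>
           pairwise (\<lambda>x y. \<not> equivalent x y) S \<and>
           (\<forall>x\<in>S. \<exists>y\<in>solutions h. equivalent x y \<and> integral_quadruple y)}"
    (is "infinite {h. ?P h}")
proof -
  have nz: "fst (orbit 0 m) \<noteq> 0" "fst (snd (snd (orbit 0 m))) \<noteq> 0" for m
    using orbit_0[of m] by auto
  have "eventually (\<lambda>h. \<forall>m\<in>{..<n}. \<not> h dvd fst (orbit 0 m)
          \<and> \<not> h dvd fst (snd (snd (orbit 0 m)))) at_top"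
    by (intro eventually_ball_finite ballI eventually_conj eventually_not_dvd nz) simp
  moreover have "eventually (\<lambda>h. \<forall>j\<in>{..<n}. \<forall>i\<in>{..<j}.
          \<not> h dvd minor (orbit 0 i) (orbit 0 j)) at_top"
    by (intro eventually_ball_finite ballI eventually_not_dvd minor_orbit_0) auto
  ultimately have "eventually ?P at_top"
  proof eventually_elim
    case (elim h)
    define p where "p m = rat_point (orbit h m)" for m
    have sol: "p m \<in> solutions h" if "m < n" for m
      unfolding p_def using elim(1) that by (intro orbit_in_solutions) auto
    have less: "\<not> equivalent (p i) (p j)" if "i < j" "j < n" for i j
      unfolding p_def using elim(2) that by (intro orbit_inequivalent) auto
    have ineq: "\<not> equivalent (p i) (p j)" if "i < n" "j < n" "i \<noteq> j" for i j
      using less[of i j] less[of j i] that equivalent_sym by (meson linorder_neqE_nat)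
    have "inj_on p {..<n}"
      by (rule inj_onI) (metis ineq equivalent_refl lessThan_iff)
    then have "card (p ` {..<n}) = n"
      by (simp add: card_image)
    moreover have "pairwise (\<lambda>x y. \<not> equivalent x y) (p ` {..<n})"
      unfolding pairwise_def by (metis imageE ineq lessThan_iff)
    moreover have "\<forall>x\<in>p ` {..<n}. \<exists>y\<in>solutions h. equivalent x y \<and> integral_quadruple y"
    proof
      fix x assume "x \<in> p ` {..<n}"
      then obtain m where m: "m < n" "x = p m" by auto
      have "integral_quadruple (p m)"
        unfolding p_def by (cases "orbit h m") simp
      then show "\<exists>y\<in>solutions h. equivalent x y \<and> integral_quadruple y"
        using sol[OF m(1)] equivalent_refl m(2) by blast
    qed
    moreover have "p ` {..<n} \<subseteq> solutions h"
      using sol by auto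
    ultimately show ?case
      by (intro exI[of _ "p ` {..<n}"] conjI) simp_all
  qed
  then show ?thesis
    by (rule infinite_if_eventually)
qed

end
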